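(* Let $\mathbb{C}$ be a double category and $X\colon\mathbb{C}^{\mathrm{op}}\to\mathbb{C}\mathrm{at}$ a lax double presheaf. The Grothendieck construction $\int\!\!\!\int_{\mathbb{C}}X$ is a strict double category.
   Context: **Double categories.** A (strict) double category $\mathbb{C}$ has objects; horizontal morphisms $f\colon x\to y$ (composition $g\circ f$, identities $1_x$); vertical morphisms $u\colon x\nrightarrow x'$ (composition $u'\bullet u$, identities $e_x$); and squares $\alpha\colon[u\,{}^{f}_{f'}\,v]$ with left boundary $u\colon x\nrightarrow x'$, right boundary $v\colon y\nrightarrow y'$, top $f\colon x\to y$ and bottom $f'\colon x'\to y'$. Squares compose horizontally ($\beta\circ\alpha$, along a common vertical morphism, identities $1_u$) and vertically ($\alpha'\bullet\alpha$, along a common horizontal morphism, identities $e_f$). All compositions are strictly associative and unital, satisfy interchange, and $e_g\circ e_f=e_{g\circ f}$, $1_{u'}\bullet 1_u=1_{u'\bullet u}$, $e_{1_x}=1_{e_x}$. $\mathbb{C}^{\mathrm{op}}$ reverses horizontal morphisms and squares horizontally. **Profunctors.** A profunctor $U\colon \mathcal{A}\nrightarrow\mathcal{A}'$ is a functor $\mathcal{A}^{\mathrm{op}}\times\mathcal{A}'\to\mathrm{Set}$. Composition: $(U'\bullet U)(a,a'')=\int^{a'}U'(a',a'')\times U(a,a')$; the class of $(s',s)$ is $[s',s]$. The identity profunctor is the hom functor, and one chooses $U\bullet e_{\mathcal{A}}=U=e_{\mathcal{A}'}\bullet U$ via the co-Yoneda isomorphisms. $\mathbb{C}\mathrm{at}$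 is the weak double category of small categories, functors (horizontal), profunctors (vertical), with squares $[U\,{}^{F}_{F'}\,V]$ the natural transformations $U\Rightarrow V(F^{\mathrm{op}}\times F')$. **Lax double presheaves.** A lax double presheaf over $\mathbb{C}$ is a normal lax double functor $X\colon\mathbb{C}^{\mathrm{op}}\to\mathbb{C}\mathrm{at}$. Explicitly: a category $Xx$ for each object $x$; a functor $Xf\colon Xy\to Xx$ for each horizontal $f\colon x\to y$; a profunctor $Xu\colon Xx^{\mathrm{op}}\times Xx'\to\mathrm{Set}$ for each vertical $u\colon x\nrightarrow x'$; a natural transformation $X\alpha\colon Xv\Rightarrow Xu(Xf^{\mathrm{op}}\times Xf')$ for each square $\alpha\colon[u\,{}^{f}_{f'}\,v]$; and a natural transformation $\mu_{u,u'}\colon Xu'\bullet Xu\Rightarrow X(u'\bullet u)$ for all composable vertical $u,u'$; such that (i) horizontal compositions and identities (of horizontal morphisms and of squares) are preserved strictly; (ii) $\mu$ is natural: $X(\alpha'\bullet\alpha)\circ\mu_{v,v'}=\mu_{u,u'}(Xf^{\mathrm{op}}\times Xf'')\circ(X\alpha'\bullet X\alpha)$ for vertically composable squares $\alpha\colon[u\,{}^{f}_{f'}\,v]$, $\alpha'\colon[u'\,{}^{f'}_{f''}\,v']$, and associative: $\mu_{u,u''\bullet u'}\circ(\mu_{u',u''}\bullet Xu)=\mu_{u'\bullet u,u''}\circ(Xu''\bullet\mu_{u,u'})$ up to the associator of profunctor composition; (iii) normality: $Xe_x$ is the hom functor of $Xx$, $Xe_f$ is the action of $Xf$ on homs, and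 $\mu_{e_x,u}$, $\mu_{u,e_{x'}}$ are identities at $Xu$. **Grothendieck construction.** $\int\!\!\!\int_{\mathbb{C}}X$ consists of: objects $(x,x_-)$, $x\in\mathbb{C}$, $x_-\in Xx$; horizontal morphisms $(x,x_-)\to(y,y_-)$ the horizontal $f\colon x\to y$ in $\mathbb{C}$ with $x_-=Xf(y_-)$; vertical morphisms $(x,x_-)\nrightarrow(x',x'_-)$ the pairs $(u,u_-)$ with $u\colon x\nrightarrow x'$ and $u_-\in Xu(x_-,x'_-)$; squares $[(u,u_-)\,{}^{f}_{f'}\,(v,v_-)]$ from left objects $(x,x_-),(x',x'_-)$ to right objects $(y,y_-),(y',y'_-)$ the squares $\alpha\colon[u\,{}^{f}_{f'}\,v]$ of $\mathbb{C}$ with $u_-=(X\alpha)_{y_-,y'_-}(v_-)$. Compositions and identities of horizontal morphisms and of squares (horizontal and vertical) are defined as in $\mathbb{C}$; $(u',u'_-)\bullet(u,u_-)=(u'\bullet u,(\mu_{u,u'})_{x_-,x''_-}([u'_-,u_-]))$; the vertical identity at $(x,x_-)$ is $(e_x,1_{x_-})$. *)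

theory Defs
  imports Main
begin

section \<open>Categories and functors\<close>

text \<open>Structures are given by explicit carriers; operations are unconstrained outside them, so
  equality of functors, profunctors and transformations always means equality on the carriers.
  Composition is written in function order: \<open>Comp A g f\<close> is ``\<open>f\<close> first, then \<open>g\<close>''.\<close>

record ('a, 'e) cat =
  Ob :: "'a set"
  Arr :: "'e set"
  Dom :: "'e \<Rightarrow> 'a"
  Cod :: "'e \<Rightarrow> 'a"
  Ident :: "'a \<Rightarrow> 'e"
  Comp :: "'e \<Rightarrow> 'e \<Rightarrow> 'e"

locale category =
  fixes A :: "('a, 'e) cat"
  assumes Dom_in: "f \<in> Arr A \<Longrightarrow> Dom A f \<in> Ob A"
    and Cod_in: "f \<in> Arr A \<Longrightarrow> Cod A f \<in> Ob A"
    and Ident_in: "a \<in> Ob A \<Longrightarrow> Ident A a \<in> Arr A"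
    and Dom_Ident: "a \<in> Ob A \<Longrightarrow> Dom A (Ident A a) = a"
    and Cod_Ident: "a \<in> Ob A \<Longrightarrow> Cod A (Ident A a) = a"
    and Comp_in: "\<lbrakk>f \<in> Arr A; g \<in> Arr A; Cod A f = Dom A g\<rbrakk> \<Longrightarrow> Comp A g f \<in> Arr A"
    and Dom_Comp: "\<lbrakk>f \<in> Arr A; g \<in> Arr A; Cod A f = Dom A g\<rbrakk> \<Longrightarrow> Dom A (Comp A g f) = Dom A f"
    and Cod_Comp: "\<lbrakk>f \<in> Arr A; g \<in> Arr A; Cod A f = Dom A g\<rbrakk> \<Longrightarrow> Cod A (Comp A g f) = Cod A g"
    and Comp_assoc: "\<lbrakk>f \<in> Arr A; g \<in> Arr A; h \<in> Arr A; Cod A f = Dom A g; Cod A g = Dom A h\<rbrakk>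
      \<Longrightarrow> Comp A h (Comp A g f) = Comp A (Comp A h g) f"
    and Comp_Ident_right: "f \<in> Arr A \<Longrightarrow> Comp A f (Ident A (Dom A f)) = f"
    and Comp_Ident_left: "f \<in> Arr A \<Longrightarrow> Comp A (Ident A (Cod A f)) f = f"

definition hom_set :: "('a, 'e) cat \<Rightarrow> 'a \<Rightarrow> 'a \<Rightarrow> 'e set" where
  "hom_set A a b = {f \<in> Arr A. Dom A f = a \<and> Cod A f = b}"

record ('a, 'e, 'b, 'k) ffun =
  on_ob :: "'a \<Rightarrow> 'b"
  on_arr :: "'e \<Rightarrow> 'k"

locale is_functor =
  fixes A :: "('a, 'e) cat" and B :: "('b, 'k) cat" and F :: "('a, 'e, 'b, 'k) ffun"
  assumes on_ob_in: "a \<in> Ob A \<Longrightarrow> on_ob F a \<in> Ob B"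
    and on_arr_in: "f \<in> Arr A \<Longrightarrow> on_arr F f \<in> Arr B"
    and Dom_on_arr: "f \<in> Arr A \<Longrightarrow> Dom B (on_arr F f) = on_ob F (Dom A f)"
    and Cod_on_arr: "f \<in> Arr A \<Longrightarrow> Cod B (on_arr F f) = on_ob F (Cod A f)"
    and on_arr_Ident: "a \<in> Ob A \<Longrightarrow> on_arr F (Ident A a) = Ident B (on_ob F a)"
    and on_arr_Comp: "\<lbrakk>f \<in> Arr A; g \<in> Arr A; Cod A f = Dom A g\<rbrakk>
      \<Longrightarrow> on_arr F (Comp A g f) = Comp B (on_arr F g) (on_arr F f)"

definition id_ffun :: "('a, 'e, 'a, 'e) ffun" where
  "id_ffun = \<lparr>on_ob = (\<lambda>a. a), on_arr = (\<lambda>f. f)\<rparr>"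

definition comp_ffun ::
    "('b, 'k, 'c, 'l) ffun \<Rightarrow> ('a, 'e, 'b, 'k) ffun \<Rightarrow> ('a, 'e, 'c, 'l) ffun" where
  "comp_ffun G F = \<lparr>on_ob = (\<lambda>a. on_ob G (on_ob F a)), on_arr = (\<lambda>f. on_arr G (on_arr F f))\<rparr>"

definition ffun_eq ::
    "('a, 'e) cat \<Rightarrow> ('a, 'e, 'b, 'k) ffun \<Rightarrow> ('a, 'e, 'b, 'k) ffun \<Rightarrow> bool" where
  "ffun_eq A F G \<longleftrightarrow>
     (\<forall>a \<in> Ob A. on_ob F a = on_ob G a) \<and> (\<forall>f \<in> Arr A. on_arr F f = on_arr G f)"

section \<open>Profunctors\<close>

text \<open>A functor from \<open>A\<^sup>o\<^sup>p \<times> A'\<close> to sets: \<open>Val U a a'\<close> is the set \<open>U(a, a')\<close>, and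
  \<open>Act U f g\<close> is the function \<open>U(f, g)\<close> from \<open>U(Cod f, Dom g)\<close> to \<open>U(Dom f, Cod g)\<close>.\<close>

record ('a, 'e, 'b, 'k, 'p) prof =
  Val :: "'a \<Rightarrow> 'b \<Rightarrow> 'p set"
  Act :: "'e \<Rightarrow> 'k \<Rightarrow> 'p \<Rightarrow> 'p"

locale profunctor =
  fixes A :: "('a, 'e) cat" and A' :: "('b, 'k) cat" and U :: "('a, 'e, 'b, 'k, 'p) prof"
  assumes Act_in: "\<lbrakk>f \<in> Arr A; g \<in> Arr A'; s \<in> Val U (Cod A f) (Dom A' g)\<rbrakk>
      \<Longrightarrow> Act U f g s \<in> Val U (Dom A f) (Cod A' g)"
    and Act_Ident: "\<lbrakk>a \<in> Ob A; a' \<in> Ob A'; s \<in> Val U a a'\<rbrakk>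
      \<Longrightarrow> Act U (Ident A a) (Ident A' a') s = s"
    and Act_Comp: "\<lbrakk>f \<in> Arr A; f1 \<in> Arr A; Cod A f1 = Dom A f;
        g \<in> Arr A'; g1 \<in> Arr A'; Cod A' g = Dom A' g1; s \<in> Val U (Cod A f) (Dom A' g)\<rbrakk>
      \<Longrightarrow> Act U (Comp A f f1) (Comp A' g1 g) s = Act U f1 g1 (Act U f g s)"

definition prof_eq ::
    "('a, 'e) cat \<Rightarrow> ('b, 'k) cat \<Rightarrow> ('a, 'e, 'b, 'k, 'p) prof \<Rightarrow> ('a, 'e, 'b, 'k, 'p) prof \<Rightarrow> bool"
  where
  "prof_eq A A' U V \<longleftrightarrow>
     (\<forall>a \<in> Ob A. \<forall>a' \<in> Ob A'. Val U a a' = Val V a a') \<and>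
     (\<forall>f \<in> Arr A. \<forall>g \<in> Arr A'. \<forall>s \<in> Val U (Cod A f) (Dom A' g). Act U f g s = Act V f g s)"

definition hom_prof :: "('a, 'e) cat \<Rightarrow> ('a, 'e, 'a, 'e, 'e) prof" where
  "hom_prof A = \<lparr>Val = hom_set A, Act = (\<lambda>f g k. Comp A g (Comp A k f))\<rparr>"

text \<open>\<open>V(F\<^sup>o\<^sup>p \<times> F')\<close>\<close>

definition prof_restrict ::
    "('c, 'l, 'd, 'n, 'p) prof \<Rightarrow> ('a, 'e, 'c, 'l) ffun \<Rightarrow> ('b, 'k, 'd, 'n) ffun
      \<Rightarrow> ('a, 'e, 'b, 'k, 'p) prof" where
  "prof_restrict V F F' =
     \<lparr>Val = (\<lambda>a a'. Val V (on_ob F a) (on_ob F' a')),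
      Act = (\<lambda>f g. Act V (on_arr F f) (on_arr F' g))\<rparr>"

definition prof_nat ::
    "('a, 'e) cat \<Rightarrow> ('b, 'k) cat \<Rightarrow> ('a, 'e, 'b, 'k, 'p) prof \<Rightarrow> ('a, 'e, 'b, 'k, 'q) prof
      \<Rightarrow> ('a \<Rightarrow> 'b \<Rightarrow> 'p \<Rightarrow> 'q) \<Rightarrow> bool" where
  "prof_nat A A' U V \<phi> \<longleftrightarrow>
     (\<forall>a \<in> Ob A. \<forall>a' \<in> Ob A'. \<forall>s \<in> Val U a a'. \<phi> a a' s \<in> Val V a a') \<and>
     (\<forall>f \<in> Arr A. \<forall>g \<in> Arr A'. \<forall>s \<in> Val U (Cod A f) (Dom A' g).
        \<phi> (Dom A f) (Cod A' g) (Act U f g s) = Act V f g (\<phi> (Cod A f) (Dom A' g) s))"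

subsection \<open>Composition of profunctors as a coend\<close>

text \<open>The coend is the quotient of the disjoint union over \<open>m\<close> of \<open>U'(m, a'') \<times> U(a, m)\<close>, with
  elements written \<open>(m, t, s)\<close>, by the equivalence relation generated by
  \<open>(m, U'(g, 1) t, s) \<sim> (n, t, U(1, g) s)\<close> for \<open>g : m \<rightarrow> n\<close>.\<close>

inductive coend_step ::
    "('a, 'e) cat \<Rightarrow> ('b, 'k) cat \<Rightarrow> ('c, 'l) cat \<Rightarrow>
     ('b, 'k, 'c, 'l, 'q) prof \<Rightarrow> ('a, 'e, 'b, 'k, 'p) prof \<Rightarrow> 'a \<Rightarrow> 'c \<Rightarrow>
     'b \<times> 'q \<times> 'p \<Rightarrow> 'b \<times> 'q \<times> 'p \<Rightarrow> bool"
  for A A' A'' U' U a a'' where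
  "\<lbrakk>g \<in> Arr A'; s \<in> Val U a (Dom A' g); t \<in> Val U' (Cod A' g) a''\<rbrakk>
    \<Longrightarrow> coend_step A A' A'' U' U a a''
          (Dom A' g, Act U' g (Ident A'' a'') t, s)
          (Cod A' g, t, Act U (Ident A a) g s)"

definition coend_class ::
    "('a, 'e) cat \<Rightarrow> ('b, 'k) cat \<Rightarrow> ('c, 'l) cat \<Rightarrow>
     ('b, 'k, 'c, 'l, 'q) prof \<Rightarrow> ('a, 'e, 'b, 'k, 'p) prof \<Rightarrow> 'a \<Rightarrow> 'c \<Rightarrow>
     'b \<times> 'q \<times> 'p \<Rightarrow> ('b \<times> 'q \<times> 'p) set" where
  "coend_class A A' A'' U' U a a'' z = {w. equivclp (coend_step A A' A'' U' U a a'') z w}"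

text \<open>The function on a quotient induced by a function \<open>h\<close> that is constant on each class.\<close>

definition descend :: "('x \<Rightarrow> 'y) \<Rightarrow> 'x set \<Rightarrow> 'y" where
  "descend h c = the_elem (h ` c)"

definition prof_comp ::
    "('a, 'e) cat \<Rightarrow> ('b, 'k) cat \<Rightarrow> ('c, 'l) cat \<Rightarrow>
     ('b, 'k, 'c, 'l, 'q) prof \<Rightarrow> ('a, 'e, 'b, 'k, 'p) prof \<Rightarrow>
     ('a, 'e, 'c, 'l, ('b \<times> 'q \<times> 'p) set) prof" where
  "prof_comp A A' A'' U' U =
     \<lparr>Val = (\<lambda>a a''. {coend_class A A' A'' U' U a a'' (m, t, s) | m t s.
                        m \<in> Ob A' \<and> t \<in> Val U' m a'' \<and> s \<in> Val U a m}),
      Act = (\<lambda>f h. descend (\<lambda>(m, t, s).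
              coend_class A A' A'' U' U (Dom A f) (Cod A'' h)
                (m, Act U' (Ident A' m) h t, Act U f (Ident A' m) s)))\<rparr>"

text \<open>Vertical composite \<open>\<beta> \<bullet> \<alpha> : U' \<bullet> U \<Rightarrow> (V' \<bullet> V)(F\<^sup>o\<^sup>p \<times> F'')\<close> of squares
  \<open>\<alpha> : U \<Rightarrow> V(F\<^sup>o\<^sup>p \<times> F')\<close> and \<open>\<beta> : U' \<Rightarrow> V'(F'\<^sup>o\<^sup>p \<times> F'')\<close>, sending \<open>[t, s]\<close> to \<open>[\<beta> t, \<alpha> s]\<close>.
  The categories are the domain and codomain categories of \<open>V\<close> and \<open>V'\<close>.\<close>

definition prof_vcomp ::
    "('d, 'i) cat \<Rightarrow> ('r, 'j) cat \<Rightarrow> ('w, 'n) cat \<Rightarrow>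
     ('r, 'j, 'w, 'n, 'y) prof \<Rightarrow> ('d, 'i, 'r, 'j, 'x) prof \<Rightarrow>
     ('a, 'e, 'd, 'i) ffun \<Rightarrow> ('b, 'k, 'r, 'j) ffun \<Rightarrow> ('c, 'l, 'w, 'n) ffun \<Rightarrow>
     ('b \<Rightarrow> 'c \<Rightarrow> 'q \<Rightarrow> 'y) \<Rightarrow> ('a \<Rightarrow> 'b \<Rightarrow> 'p \<Rightarrow> 'x) \<Rightarrow>
     'a \<Rightarrow> 'c \<Rightarrow> ('b \<times> 'q \<times> 'p) set \<Rightarrow> ('r \<times> 'y \<times> 'x) set" where
  "prof_vcomp B B' B'' V' V F F' F'' \<beta> \<alpha> a a'' =
     descend (\<lambda>(m, t, s). coend_class B B' B'' V' V (on_ob F a) (on_ob F'' a'')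
       (on_ob F' m, \<beta> m a'' t, \<alpha> a m s))"

text \<open>The associator \<open>(U'' \<bullet> U') \<bullet> U \<cong> U'' \<bullet> (U' \<bullet> U)\<close>, sending \<open>[[r, t], s]\<close> to \<open>[r, [t, s]]\<close>.\<close>

definition prof_assoc ::
    "('a, 'e) cat \<Rightarrow> ('b, 'k) cat \<Rightarrow> ('c, 'l) cat \<Rightarrow> ('d, 'n) cat \<Rightarrow>
     ('c, 'l, 'd, 'n, 'r) prof \<Rightarrow> ('b, 'k, 'c, 'l, 'q) prof \<Rightarrow> ('a, 'e, 'b, 'k, 'p) prof \<Rightarrow>
     'a \<Rightarrow> 'd \<Rightarrow> ('b \<times> ('c \<times> 'r \<times> 'q) set \<times> 'p) set \<Rightarrow>
     ('c \<times> 'r \<times> ('b \<times> 'q \<times> 'p) set) set" where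
  "prof_assoc A0 A1 A2 A3 U'' U' U a d =
     descend (\<lambda>(m, c, s). descend (\<lambda>(n, r, t).
       coend_class A0 A2 A3 U'' (prof_comp A0 A1 A2 U' U) a d
         (n, r, coend_class A0 A1 A2 U' U a n (m, t, s))) c)"

text \<open>The co-Yoneda isomorphisms \<open>U \<bullet> e\<^sub>A \<cong> U\<close> and \<open>e\<^sub>A\<^sub>' \<bullet> U \<cong> U\<close>, sending
  \<open>[s, f]\<close> to \<open>U(f, 1) s\<close> and \<open>[g, s]\<close> to \<open>U(1, g) s\<close>.\<close>

definition coyoneda_dom ::
    "('b, 'k) cat \<Rightarrow> ('a, 'e, 'b, 'k, 'p) prof \<Rightarrow> 'a \<Rightarrow> 'b \<Rightarrow> ('a \<times> 'p \<times> 'e) set \<Rightarrow> 'p" where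
  "coyoneda_dom A' U a a' = descend (\<lambda>(m, s, f). Act U f (Ident A' a') s)"

definition coyoneda_cod ::
    "('a, 'e) cat \<Rightarrow> ('a, 'e, 'b, 'k, 'p) prof \<Rightarrow> 'a \<Rightarrow> 'b \<Rightarrow> ('b \<times> 'k \<times> 'p) set \<Rightarrow> 'p" where
  "coyoneda_cod A U a a' = descend (\<lambda>(m, g, s). Act U (Ident A a) g s)"

section \<open>Strict double categories\<close>

record ('o, 'h, 'v, 's) double_cat =
  Obj :: "'o set"
  Hor :: "'h set"
  Ver :: "'v set"
  Sq :: "'s set"
  hdom :: "'h \<Rightarrow> 'o"
  hcod :: "'h \<Rightarrow> 'o"
  hid :: "'o \<Rightarrow> 'h"
  hcomp :: "'h \<Rightarrow> 'h \<Rightarrow> 'h"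
  vdom :: "'v \<Rightarrow> 'o"
  vcod :: "'v \<Rightarrow> 'o"
  vid :: "'o \<Rightarrow> 'v"
  vcomp :: "'v \<Rightarrow> 'v \<Rightarrow> 'v"
  sq_left :: "'s \<Rightarrow> 'v"
  sq_right :: "'s \<Rightarrow> 'v"
  sq_top :: "'s \<Rightarrow> 'h"
  sq_bot :: "'s \<Rightarrow> 'h"
  sq_hid :: "'v \<Rightarrow> 's"
  sq_hcomp :: "'s \<Rightarrow> 's \<Rightarrow> 's"
  sq_vid :: "'h \<Rightarrow> 's"
  sq_vcomp :: "'s \<Rightarrow> 's \<Rightarrow> 's"

definition hor_cat :: "('o, 'h, 'v, 's) double_cat \<Rightarrow> ('o, 'h) cat" where
  "hor_cat C = \<lparr>Ob = Obj C, Arr = Hor C, Dom = hdom C, Cod = hcod C,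
                Ident = hid C, Comp = hcomp C\<rparr>"

definition ver_cat :: "('o, 'h, 'v, 's) double_cat \<Rightarrow> ('o, 'v) cat" where
  "ver_cat C = \<lparr>Ob = Obj C, Arr = Ver C, Dom = vdom C, Cod = vcod C,
                Ident = vid C, Comp = vcomp C\<rparr>"

definition sq_hor_cat :: "('o, 'h, 'v, 's) double_cat \<Rightarrow> ('v, 's) cat" where
  "sq_hor_cat C = \<lparr>Ob = Ver C, Arr = Sq C, Dom = sq_left C, Cod = sq_right C,
                   Ident = sq_hid C, Comp = sq_hcomp C\<rparr>"

definition sq_ver_cat :: "('o, 'h, 'v, 's) double_cat \<Rightarrow> ('h, 's) cat" where
  "sq_ver_cat C = \<lparr>Ob = Hor C, Arr = Sq C, Dom = sq_top C, Cod = sq_bot C,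
                   Ident = sq_vid C, Comp = sq_vcomp C\<rparr>"

locale double_category =
  fixes C :: "('o, 'h, 'v, 's) double_cat"
  assumes hor: "category (hor_cat C)"
    and ver: "category (ver_cat C)"
    and sq_hor: "category (sq_hor_cat C)"
    and sq_ver: "category (sq_ver_cat C)"
    and corner_left_top: "\<alpha> \<in> Sq C \<Longrightarrow> vdom C (sq_left C \<alpha>) = hdom C (sq_top C \<alpha>)"
    and corner_left_bot: "\<alpha> \<in> Sq C \<Longrightarrow> vcod C (sq_left C \<alpha>) = hdom C (sq_bot C \<alpha>)"
    and corner_right_top: "\<alpha> \<in> Sq C \<Longrightarrow> vdom C (sq_right C \<alpha>) = hcod C (sq_top C \<alpha>)"
    and corner_right_bot: "\<alpha> \<in> Sq C \<Longrightarrow> vcod C (sq_right C \<alpha>) = hcod C (sq_bot C \<alpha>)"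
    and top_hid: "u \<in> Ver C \<Longrightarrow> sq_top C (sq_hid C u) = hid C (vdom C u)"
    and bot_hid: "u \<in> Ver C \<Longrightarrow> sq_bot C (sq_hid C u) = hid C (vcod C u)"
    and left_vid: "f \<in> Hor C \<Longrightarrow> sq_left C (sq_vid C f) = vid C (hdom C f)"
    and right_vid: "f \<in> Hor C \<Longrightarrow> sq_right C (sq_vid C f) = vid C (hcod C f)"
    and top_hcomp: "\<lbrakk>\<alpha> \<in> Sq C; \<beta> \<in> Sq C; sq_right C \<alpha> = sq_left C \<beta>\<rbrakk>
      \<Longrightarrow> sq_top C (sq_hcomp C \<beta> \<alpha>) = hcomp C (sq_top C \<beta>) (sq_top C \<alpha>)"
    and bot_hcomp: "\<lbrakk>\<alpha> \<in> Sq C; \<beta> \<in> Sq C; sq_right C \<alpha> = sq_left C \<beta>\<rbrakk>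
      \<Longrightarrow> sq_bot C (sq_hcomp C \<beta> \<alpha>) = hcomp C (sq_bot C \<beta>) (sq_bot C \<alpha>)"
    and left_vcomp: "\<lbrakk>\<alpha> \<in> Sq C; \<alpha>' \<in> Sq C; sq_bot C \<alpha> = sq_top C \<alpha>'\<rbrakk>
      \<Longrightarrow> sq_left C (sq_vcomp C \<alpha>' \<alpha>) = vcomp C (sq_left C \<alpha>') (sq_left C \<alpha>)"
    and right_vcomp: "\<lbrakk>\<alpha> \<in> Sq C; \<alpha>' \<in> Sq C; sq_bot C \<alpha> = sq_top C \<alpha>'\<rbrakk>
      \<Longrightarrow> sq_right C (sq_vcomp C \<alpha>' \<alpha>) = vcomp C (sq_right C \<alpha>') (sq_right C \<alpha>)"
    and interchange: "\<lbrakk>\<alpha> \<in> Sq C; \<beta> \<in> Sq C; \<alpha>' \<in> Sq C; \<beta>' \<in> Sq C;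
        sq_right C \<alpha> = sq_left C \<beta>; sq_right C \<alpha>' = sq_left C \<beta>';
        sq_bot C \<alpha> = sq_top C \<alpha>'; sq_bot C \<beta> = sq_top C \<beta>'\<rbrakk>
      \<Longrightarrow> sq_vcomp C (sq_hcomp C \<beta>' \<alpha>') (sq_hcomp C \<beta> \<alpha>)
        = sq_hcomp C (sq_vcomp C \<beta>' \<beta>) (sq_vcomp C \<alpha>' \<alpha>)"
    and hcomp_vid: "\<lbrakk>f \<in> Hor C; g \<in> Hor C; hcod C f = hdom C g\<rbrakk>
      \<Longrightarrow> sq_hcomp C (sq_vid C g) (sq_vid C f) = sq_vid C (hcomp C g f)"
    and vcomp_hid: "\<lbrakk>u \<in> Ver C; u' \<in> Ver C; vcod C u = vdom C u'\<rbrakk>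
      \<Longrightarrow> sq_vcomp C (sq_hid C u') (sq_hid C u) = sq_hid C (vcomp C u' u)"
    and vid_hid: "x \<in> Obj C \<Longrightarrow> sq_vid C (hid C x) = sq_hid C (vid C x)"

section \<open>Lax double presheaves\<close>

text \<open>\<open>pmu X u u'\<close> is \<open>\<mu>\<^sub>u\<^sub>,\<^sub>u\<^sub>' : Xu' \<bullet> Xu \<Rightarrow> X(u' \<bullet> u)\<close>. The types \<open>'a\<close> and \<open>'e\<close> act as
  universes containing the objects, respectively the arrows, of all the categories \<open>Xx\<close>; since
  normality makes \<open>Xe\<^sub>x\<close> literally the hom profunctor, the elements of all the sets \<open>Xu(a, a')\<close>
  live in the type \<open>'e\<close> as well.\<close>

record ('o, 'h, 'v, 's, 'a, 'e) double_presheaf =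
  pcat :: "'o \<Rightarrow> ('a, 'e) cat"
  pfun :: "'h \<Rightarrow> ('a, 'e, 'a, 'e) ffun"
  pprof :: "'v \<Rightarrow> ('a, 'e, 'a, 'e, 'e) prof"
  psq :: "'s \<Rightarrow> 'a \<Rightarrow> 'a \<Rightarrow> 'e \<Rightarrow> 'e"
  pmu :: "'v \<Rightarrow> 'v \<Rightarrow> 'a \<Rightarrow> 'a \<Rightarrow> ('a \<times> 'e \<times> 'e) set \<Rightarrow> 'e"

definition pcomp ::
    "('o, 'h, 'v, 's) double_cat \<Rightarrow> ('o, 'h, 'v, 's, 'a, 'e) double_presheaf \<Rightarrow> 'v \<Rightarrow> 'v \<Rightarrow>
     ('a, 'e, 'a, 'e, ('a \<times> 'e \<times> 'e) set) prof" where
  "pcomp C X u' u = prof_comp (pcat X (vdom C u)) (pcat X (vcod C u)) (pcat X (vcod C u'))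
                      (pprof X u') (pprof X u)"

definition pclass ::
    "('o, 'h, 'v, 's) double_cat \<Rightarrow> ('o, 'h, 'v, 's, 'a, 'e) double_presheaf \<Rightarrow> 'v \<Rightarrow> 'v \<Rightarrow>
     'a \<Rightarrow> 'a \<Rightarrow> 'a \<times> 'e \<times> 'e \<Rightarrow> ('a \<times> 'e \<times> 'e) set" where
  "pclass C X u' u = coend_class (pcat X (vdom C u)) (pcat X (vcod C u)) (pcat X (vcod C u'))
                       (pprof X u') (pprof X u)"

locale lax_double_presheaf = double_category C
  for C :: "('o, 'h, 'v, 's) double_cat" +
  fixes X :: "('o, 'h, 'v, 's, 'a, 'e) double_presheaf"
  assumes X_cat: "x \<in> Obj C \<Longrightarrow> category (pcat X x)"
    and X_fun: "f \<in> Hor C \<Longrightarrow> is_functor (pcat X (hcod C f)) (pcat X (hdom C f)) (pfun X f)"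
    and X_prof: "u \<in> Ver C \<Longrightarrow> profunctor (pcat X (vdom C u)) (pcat X (vcod C u)) (pprof X u)"
    and X_sq: "\<alpha> \<in> Sq C \<Longrightarrow>
      prof_nat (pcat X (vdom C (sq_right C \<alpha>))) (pcat X (vcod C (sq_right C \<alpha>)))
        (pprof X (sq_right C \<alpha>))
        (prof_restrict (pprof X (sq_left C \<alpha>)) (pfun X (sq_top C \<alpha>)) (pfun X (sq_bot C \<alpha>)))
        (psq X \<alpha>)"
    and X_mu: "\<lbrakk>u \<in> Ver C; u' \<in> Ver C; vcod C u = vdom C u'\<rbrakk> \<Longrightarrow>
      prof_nat (pcat X (vdom C u)) (pcat X (vcod C u'))
        (pcomp C X u' u) (pprof X (vcomp C u' u)) (pmu X u u')"
    \<comment> \<open>strict functoriality in the horizontal direction\<close>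
    and X_hcomp: "\<lbrakk>f \<in> Hor C; g \<in> Hor C; hcod C f = hdom C g\<rbrakk> \<Longrightarrow>
      ffun_eq (pcat X (hcod C g)) (pfun X (hcomp C g f)) (comp_ffun (pfun X f) (pfun X g))"
    and X_hid: "x \<in> Obj C \<Longrightarrow> ffun_eq (pcat X x) (pfun X (hid C x)) id_ffun"
    and X_sq_hcomp: "\<lbrakk>\<alpha> \<in> Sq C; \<beta> \<in> Sq C; sq_right C \<alpha> = sq_left C \<beta>;
        z \<in> Ob (pcat X (vdom C (sq_right C \<beta>))); z' \<in> Ob (pcat X (vcod C (sq_right C \<beta>)));
        r \<in> Val (pprof X (sq_right C \<beta>)) z z'\<rbrakk> \<Longrightarrow>
      psq X (sq_hcomp C \<beta> \<alpha>) z z' r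
        = psq X \<alpha> (on_ob (pfun X (sq_top C \<beta>)) z) (on_ob (pfun X (sq_bot C \<beta>)) z')
            (psq X \<beta> z z' r)"
    and X_sq_hid: "\<lbrakk>u \<in> Ver C; a \<in> Ob (pcat X (vdom C u)); a' \<in> Ob (pcat X (vcod C u));
        s \<in> Val (pprof X u) a a'\<rbrakk> \<Longrightarrow> psq X (sq_hid C u) a a' s = s"
    \<comment> \<open>naturality and associativity of \<open>\<mu>\<close>\<close>
    and mu_natural: "\<lbrakk>\<alpha> \<in> Sq C; \<alpha>' \<in> Sq C; sq_bot C \<alpha> = sq_top C \<alpha>';
        y \<in> Ob (pcat X (vdom C (sq_right C \<alpha>))); y'' \<in> Ob (pcat X (vcod C (sq_right C \<alpha>')));
        c \<in> Val (pcomp C X (sq_right C \<alpha>') (sq_right C \<alpha>)) y y''\<rbrakk> \<Longrightarrow>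
      psq X (sq_vcomp C \<alpha>' \<alpha>) y y'' (pmu X (sq_right C \<alpha>) (sq_right C \<alpha>') y y'' c)
        = pmu X (sq_left C \<alpha>) (sq_left C \<alpha>')
            (on_ob (pfun X (sq_top C \<alpha>)) y) (on_ob (pfun X (sq_bot C \<alpha>')) y'')
            (prof_vcomp (pcat X (vdom C (sq_left C \<alpha>))) (pcat X (vcod C (sq_left C \<alpha>)))
               (pcat X (vcod C (sq_left C \<alpha>'))) (pprof X (sq_left C \<alpha>')) (pprof X (sq_left C \<alpha>))
               (pfun X (sq_top C \<alpha>)) (pfun X (sq_bot C \<alpha>)) (pfun X (sq_bot C \<alpha>'))
               (psq X \<alpha>') (psq X \<alpha>) y y'' c)"
    and mu_assoc: "\<lbrakk>u \<in> Ver C; u' \<in> Ver C; u'' \<in> Ver C; vcod C u = vdom C u'; vcod C u' = vdom C u'';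
        A0 = pcat X (vdom C u); A1 = pcat X (vcod C u);
        A2 = pcat X (vcod C u'); A3 = pcat X (vcod C u'');
        a \<in> Ob A0; d \<in> Ob A3;
        e \<in> Val (prof_comp A0 A1 A3 (pcomp C X u'' u') (pprof X u)) a d\<rbrakk> \<Longrightarrow>
      pmu X u (vcomp C u'' u') a d
          (prof_vcomp A0 A1 A3 (pprof X (vcomp C u'' u')) (pprof X u)
             id_ffun id_ffun id_ffun (pmu X u' u'') (\<lambda>_ _ s. s) a d e)
        = pmu X (vcomp C u' u) u'' a d
            (prof_vcomp A0 A2 A3 (pprof X u'') (pprof X (vcomp C u' u))
               id_ffun id_ffun id_ffun (\<lambda>_ _ s. s) (pmu X u u') a d
               (prof_assoc A0 A1 A2 A3 (pprof X u'') (pprof X u') (pprof X u) a d e))"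
    \<comment> \<open>normality\<close>
    and X_vid: "x \<in> Obj C \<Longrightarrow> prof_eq (pcat X x) (pcat X x) (pprof X (vid C x)) (hom_prof (pcat X x))"
    and X_sq_vid: "\<lbrakk>f \<in> Hor C; k \<in> Arr (pcat X (hcod C f))\<rbrakk> \<Longrightarrow>
      psq X (sq_vid C f) (Dom (pcat X (hcod C f)) k) (Cod (pcat X (hcod C f)) k) k
        = on_arr (pfun X f) k"
    and mu_vid_dom: "\<lbrakk>u \<in> Ver C; a \<in> Ob (pcat X (vdom C u)); a' \<in> Ob (pcat X (vcod C u));
        c \<in> Val (pcomp C X u (vid C (vdom C u))) a a'\<rbrakk> \<Longrightarrow>
      pmu X (vid C (vdom C u)) u a a' c = coyoneda_dom (pcat X (vcod C u)) (pprof X u) a a' c"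
    and mu_vid_cod: "\<lbrakk>u \<in> Ver C; a \<in> Ob (pcat X (vdom C u)); a' \<in> Ob (pcat X (vcod C u));
        c \<in> Val (pcomp C X (vid C (vcod C u)) u) a a'\<rbrakk> \<Longrightarrow>
      pmu X u (vid C (vcod C u)) a a' c = coyoneda_cod (pcat X (vdom C u)) (pprof X u) a a' c"

section \<open>The Grothendieck construction\<close>

text \<open>Morphisms and squares carry their boundaries, since the same \<open>f\<close> or \<open>\<alpha>\<close> of the base can
  underlie several of them.\<close>

datatype ('o, 'h, 'a) groth_hor =
  GHor (gh_dom: "'o \<times> 'a") (gh_base: 'h) (gh_cod: "'o \<times> 'a")

datatype ('o, 'v, 'a, 'e) groth_ver =
  GVer (gv_dom: "'o \<times> 'a") (gv_base: 'v) (gv_elem: 'e) (gv_cod: "'o \<times> 'a")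

datatype ('o, 'h, 'v, 's, 'a, 'e) groth_sq =
  GSq (gs_left: "('o, 'v, 'a, 'e) groth_ver")
      (gs_top: "('o, 'h, 'a) groth_hor")
      (gs_bot: "('o, 'h, 'a) groth_hor")
      (gs_right: "('o, 'v, 'a, 'e) groth_ver")
      (gs_base: 's)

context
  fixes C :: "('o, 'h, 'v, 's) double_cat"
    and X :: "('o, 'h, 'v, 's, 'a, 'e) double_presheaf"
begin

definition groth_Obj :: "('o \<times> 'a) set" where
  "groth_Obj = {(x, a). x \<in> Obj C \<and> a \<in> Ob (pcat X x)}"

definition groth_Hor :: "('o, 'h, 'a) groth_hor set" where
  "groth_Hor = {GHor (x, a) f (y, b) | x a f y b.
     (x, a) \<in> groth_Obj \<and> (y, b) \<in> groth_Obj \<and>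
     f \<in> Hor C \<and> hdom C f = x \<and> hcod C f = y \<and> a = on_ob (pfun X f) b}"

definition groth_Ver :: "('o, 'v, 'a, 'e) groth_ver set" where
  "groth_Ver = {GVer (x, a) u s (x', a') | x a u s x' a'.
     (x, a) \<in> groth_Obj \<and> (x', a') \<in> groth_Obj \<and>
     u \<in> Ver C \<and> vdom C u = x \<and> vcod C u = x' \<and> s \<in> Val (pprof X u) a a'}"

definition groth_Sq :: "('o, 'h, 'v, 's, 'a, 'e) groth_sq set" where
  "groth_Sq = {GSq (GVer p u s p') (GHor p f q) (GHor p' f' q') (GVer q v t q') \<alpha>
     | p u s p' f f' q v t q' \<alpha>.
     GVer p u s p' \<in> groth_Ver \<and> GVer q v t q' \<in> groth_Ver \<and>
     GHor p f q \<in> groth_Hor \<and> GHor p' f' q' \<in> groth_Hor \<and>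
     \<alpha> \<in> Sq C \<and> sq_left C \<alpha> = u \<and> sq_top C \<alpha> = f \<and> sq_bot C \<alpha> = f' \<and> sq_right C \<alpha> = v \<and>
     s = psq X \<alpha> (snd q) (snd q') t}"

definition groth_hid :: "'o \<times> 'a \<Rightarrow> ('o, 'h, 'a) groth_hor" where
  "groth_hid p = GHor p (hid C (fst p)) p"

definition groth_hcomp ::
    "('o, 'h, 'a) groth_hor \<Rightarrow> ('o, 'h, 'a) groth_hor \<Rightarrow> ('o, 'h, 'a) groth_hor" where
  "groth_hcomp g f = GHor (gh_dom f) (hcomp C (gh_base g) (gh_base f)) (gh_cod g)"

definition groth_vid :: "'o \<times> 'a \<Rightarrow> ('o, 'v, 'a, 'e) groth_ver" where
  "groth_vid p = GVer p (vid C (fst p)) (Ident (pcat X (fst p)) (snd p)) p"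

definition groth_vcomp ::
    "('o, 'v, 'a, 'e) groth_ver \<Rightarrow> ('o, 'v, 'a, 'e) groth_ver \<Rightarrow> ('o, 'v, 'a, 'e) groth_ver" where
  "groth_vcomp u' u = GVer (gv_dom u) (vcomp C (gv_base u') (gv_base u))
     (pmu X (gv_base u) (gv_base u') (snd (gv_dom u)) (snd (gv_cod u'))
        (pclass C X (gv_base u') (gv_base u) (snd (gv_dom u)) (snd (gv_cod u'))
           (snd (gv_cod u), gv_elem u', gv_elem u)))
     (gv_cod u')"

definition grothendieck ::
    "('o \<times> 'a, ('o, 'h, 'a) groth_hor, ('o, 'v, 'a, 'e) groth_ver,
      ('o, 'h, 'v, 's, 'a, 'e) groth_sq) double_cat" where
  "grothendieck =
     \<lparr>Obj = groth_Obj, Hor = groth_Hor, Ver = groth_Ver, Sq = groth_Sq,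
      hdom = gh_dom, hcod = gh_cod, hid = groth_hid, hcomp = groth_hcomp,
      vdom = gv_dom, vcod = gv_cod, vid = groth_vid, vcomp = groth_vcomp,
      sq_left = gs_left, sq_right = gs_right, sq_top = gs_top, sq_bot = gs_bot,
      sq_hid = (\<lambda>u. GSq u (groth_hid (gv_dom u)) (groth_hid (gv_cod u)) u
                        (sq_hid C (gv_base u))),
      sq_hcomp = (\<lambda>\<beta> \<alpha>. GSq (gs_left \<alpha>) (groth_hcomp (gs_top \<beta>) (gs_top \<alpha>))
                        (groth_hcomp (gs_bot \<beta>) (gs_bot \<alpha>)) (gs_right \<beta>)
                        (sq_hcomp C (gs_base \<beta>) (gs_base \<alpha>))),
      sq_vid = (\<lambda>f. GSq (groth_vid (gh_dom f)) f f (groth_vid (gh_cod f))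
                        (sq_vid C (gh_base f))),
      sq_vcomp = (\<lambda>\<alpha>' \<alpha>. GSq (groth_vcomp (gs_left \<alpha>') (gs_left \<alpha>)) (gs_top \<alpha>)
                        (gs_bot \<alpha>') (groth_vcomp (gs_right \<alpha>') (gs_right \<alpha>))
                        (sq_vcomp C (gs_base \<alpha>') (gs_base \<alpha>)))\<rparr>"

end

end

theory Submission
  imports Defs
begin

text \<open>In the Grothendieck construction a horizontal morphism or a square is one of \<open>C\<close> whose
  boundary carries elements related by the maps \<open>Xf\<close> or \<open>X\<alpha>\<close>. Because \<open>f \<mapsto> Xf\<close> and
  \<open>\<alpha> \<mapsto> X\<alpha>\<close> preserve horizontal composition and identities on the nose, these relations persist
  under horizontal composition, and the horizontal laws are those of \<open>C\<close>.

  Vertical composition is where the laxity of \<open>X\<close> enters: elements \<open>s\<close> and \<open>s'\<close> are combined by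
  applying \<open>\<mu>\<close> to the class \<open>[s', s]\<close> in a coend. Each axiom on \<open>\<mu>\<close> is an equation between maps out
  of a coend, and evaluating it at a class of representatives gives the law that is needed.
  Associativity of \<open>\<mu>\<close> gives associativity of vertical composition (\<open>groth_vcomp_assoc\<close>), normality
  and the co-Yoneda isomorphisms give the unit laws (\<open>groth_vcomp_vid_right\<close>,
  \<open>groth_vcomp_vid_left\<close>), and naturality of \<open>\<mu>\<close> says that squares are closed under vertical
  composition (\<open>groth_sq_vcomp_in\<close>). Vertical identity squares exist because \<open>Xe\<^sub>f\<close> is the action of
  the functor \<open>Xf\<close>, which preserves identities (\<open>groth_sq_vid_in\<close>).

  What makes the evaluation legitimate is that every map involved is given on representatives by a
  formula that identifies the two sides of each generating step of the coend relation. This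
  is checked once for the action on a composite profunctor, the vertical composite of
  transformations, the associator and the co-Yoneda maps.

  Finally, a square is determined by its boundary and its underlying square of \<open>C\<close>, since its only
  further content is an equation between elements. So all laws between squares, interchange
  included, hold because they hold in \<open>C\<close> and on boundaries.\<close>

section \<open>Computing with classes in a coend\<close>

lemma coend_class_step:
  assumes "g \<in> Arr A'" "s \<in> Val U a (Dom A' g)" "t \<in> Val U' (Cod A' g) a''"
  shows "coend_class A A' A'' U' U a a'' (Dom A' g, Act U' g (Ident A'' a'') t, s)
    = coend_class A A' A'' U' U a a'' (Cod A' g, t, Act U (Ident A a) g s)"
proof -
  let ?z = "(Dom A' g, Act U' g (Ident A'' a'') t, s)"
    and ?w = "(Cod A' g, t, Act U (Ident A a) g s)"
  have "equivclp (coend_step A A' A'' U' U a a'') ?z ?w"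
    by (intro r_into_equivclp coend_step.intros assms)
  then show ?thesis
    unfolding coend_class_def by (auto intro: equivclp_trans equivclp_sym)
qed

text \<open>A map defined on representatives descends as soon as it identifies the two sides of each
  generating step; every later evaluation at a class goes through this rule.\<close>

lemma descend_coend_class:
  assumes step: "\<And>g s t. \<lbrakk>g \<in> Arr A'; s \<in> Val U a (Dom A' g); t \<in> Val U' (Cod A' g) a''\<rbrakk>
      \<Longrightarrow> h (Dom A' g, Act U' g (Ident A'' a'') t, s) = h (Cod A' g, t, Act U (Ident A a) g s)"
  shows "descend h (coend_class A A' A'' U' U a a'' z) = h z"
proof -
  let ?R = "coend_step A A' A'' U' U a a''"
  have 1: "h v = h w" if "?R v w" for v w
    using that by cases (simp add: step)
  have 2: "h z = h w" if "equivclp ?R z w" for w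
    using that by (induction rule: equivclp_induct) (auto dest: 1)
  have "equivclp ?R z z" by simp
  with 2 have "h ` coend_class A A' A'' U' U a a'' z = {h z}"
    unfolding coend_class_def by force
  then show ?thesis by (simp add: descend_def)
qed

lemma coend_class_in_prof_comp:
  assumes "m \<in> Ob A'" "t \<in> Val U' m a''" "s \<in> Val U a m"
  shows "coend_class A A' A'' U' U a a'' (m, t, s) \<in> Val (prof_comp A A' A'' U' U) a a''"
  using assms by (auto simp: prof_comp_def)

lemma prof_comp_ValE:
  assumes "c \<in> Val (prof_comp A A' A'' U' U) a a''"
  obtains m t s where "m \<in> Ob A'" "t \<in> Val U' m a''" "s \<in> Val U a m"
    "c = coend_class A A' A'' U' U a a'' (m, t, s)"
  using assms by (auto simp: prof_comp_def)

text \<open>Both factorisations of \<open>(f, g)\<close> in the product category act alike. This lets an action on the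
  outer variables move past the action on the middle variable in a generating step.\<close>

lemma Act_split:
  assumes "category A" "category A'" "profunctor A A' U"
    and fg: "f \<in> Arr A" "g \<in> Arr A'" "s \<in> Val U (Cod A f) (Dom A' g)"
  shows "Act U f (Ident A' (Cod A' g)) (Act U (Ident A (Cod A f)) g s) = Act U f g s"
    and "Act U (Ident A (Dom A f)) g (Act U f (Ident A' (Dom A' g)) s) = Act U f g s"
proof -
  interpret A: category A by fact
  interpret A': category A' by fact
  interpret U: profunctor A A' U by fact
  show "Act U f (Ident A' (Cod A' g)) (Act U (Ident A (Cod A f)) g s) = Act U f g s"
    using U.Act_Comp[of "Ident A (Cod A f)" f g "Ident A' (Cod A' g)" s] fg
    by (simp add: A.Ident_in A.Cod_in A.Dom_Ident A.Cod_Ident A.Comp_Ident_left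
        A'.Ident_in A'.Cod_in A'.Dom_Ident A'.Comp_Ident_left)
  show "Act U (Ident A (Dom A f)) g (Act U f (Ident A' (Dom A' g)) s) = Act U f g s"
    using U.Act_Comp[of f "Ident A (Dom A f)" "Ident A' (Dom A' g)" g s] fg
    by (simp add: A.Ident_in A.Dom_in A.Cod_Ident A.Comp_Ident_right
        A'.Ident_in A'.Dom_in A'.Dom_Ident A'.Cod_Ident A'.Comp_Ident_right)
qed

lemma Act_prof_comp_class:
  assumes "category A" "category A'" "category A''"
    and U: "profunctor A A' U" and U': "profunctor A' A'' U'"
    and f: "f \<in> Arr A" and h: "h \<in> Arr A''"
  shows "Act (prof_comp A A' A'' U' U) f h
      (coend_class A A' A'' U' U (Cod A f) (Dom A'' h) (m, t, s))
    = coend_class A A' A'' U' U (Dom A f) (Cod A'' h)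
        (m, Act U' (Ident A' m) h t, Act U f (Ident A' m) s)"
proof -
  interpret A: category A by fact
  interpret A': category A' by fact
  interpret A'': category A'' by fact
  interpret U: profunctor A A' U by fact
  interpret U': profunctor A' A'' U' by fact
  let ?K = "coend_class A A' A'' U' U (Dom A f) (Cod A'' h)"
  show ?thesis
    unfolding prof_comp_def prof.simps
  proof (subst descend_coend_class, unfold prod.case, goal_cases)
    case (1 g s t)
    let ?s = "Act U f (Ident A' (Dom A' g)) s" and ?t = "Act U' (Ident A' (Cod A' g)) h t"
    have s: "?s \<in> Val U (Dom A f) (Dom A' g)"
      using U.Act_in[of f "Ident A' (Dom A' g)" s] 1 f
      by (simp add: A'.Ident_in A'.Dom_in A'.Dom_Ident A'.Cod_Ident)
    have t: "?t \<in> Val U' (Cod A' g) (Cod A'' h)"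
      using U'.Act_in[of "Ident A' (Cod A' g)" h t] 1 h
      by (simp add: A'.Ident_in A'.Cod_in A'.Dom_Ident A'.Cod_Ident)
    have "Act U' (Ident A' (Dom A' g)) h (Act U' g (Ident A'' (Dom A'' h)) t)
        = Act U' g (Ident A'' (Cod A'' h)) ?t"
      using Act_split[OF _ _ U', of g h t] 1 h A'.category_axioms A''.category_axioms by simp
    moreover have "Act U f (Ident A' (Cod A' g)) (Act U (Ident A (Cod A f)) g s)
        = Act U (Ident A (Dom A f)) g ?s"
      using Act_split[OF _ _ U, of f g s] 1 f A.category_axioms A'.category_axioms by simp
    ultimately show ?case
      using coend_class_step[OF 1(1) s t] by simp
  qed simp
qed

text \<open>Naturality of the two squares with respect to the middle variable is what makes
  \<open>[t, s] \<mapsto> [\<beta> t, \<alpha> s]\<close> compatible with the generating steps.\<close>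

lemma prof_vcomp_class:
  assumes "category A" "category A''"
    and "is_functor A B F" "is_functor A' B' F'" "is_functor A'' B'' F''"
    and \<alpha>: "prof_nat A A' U (prof_restrict V F F') \<alpha>"
    and \<beta>: "prof_nat A' A'' U' (prof_restrict V' F' F'') \<beta>"
    and "category A'" and a: "a \<in> Ob A" and a'': "a'' \<in> Ob A''"
  shows "prof_vcomp B B' B'' V' V F F' F'' \<beta> \<alpha> a a'' (coend_class A A' A'' U' U a a'' (m, t, s))
    = coend_class B B' B'' V' V (on_ob F a) (on_ob F'' a'') (on_ob F' m, \<beta> m a'' t, \<alpha> a m s)"
proof -
  interpret A: category A by fact
  interpret A': category A' by fact
  interpret A'': category A'' by fact
  interpret F: is_functor A B F by fact
  interpret F': is_functor A' B' F' by fact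
  interpret F'': is_functor A'' B'' F'' by fact
  show ?thesis
    unfolding prof_vcomp_def
  proof (subst descend_coend_class, unfold prod.case, goal_cases)
    case (1 g s t)
    have "\<beta> (Dom A' g) a'' (Act U' g (Ident A'' a'') t)
        = Act V' (on_arr F' g) (Ident B'' (on_ob F'' a'')) (\<beta> (Cod A' g) a'' t)"
      using \<beta>[unfolded prof_nat_def, THEN conjunct2, rule_format, of g "Ident A'' a''" t] 1 a''
      by (simp add: prof_restrict_def A''.Ident_in A''.Dom_Ident A''.Cod_Ident F''.on_arr_Ident)
    moreover have "\<alpha> a (Cod A' g) (Act U (Ident A a) g s)
        = Act V (Ident B (on_ob F a)) (on_arr F' g) (\<alpha> a (Dom A' g) s)"
      using \<alpha>[unfolded prof_nat_def, THEN conjunct2, rule_format, of "Ident A a" g s] 1 a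
      by (simp add: prof_restrict_def A.Ident_in A.Dom_Ident A.Cod_Ident F.on_arr_Ident)
    moreover have "\<beta> (Cod A' g) a'' t \<in> Val V' (on_ob F' (Cod A' g)) (on_ob F'' a'')"
      using \<beta>[unfolded prof_nat_def] 1 a'' by (simp add: prof_restrict_def A'.Cod_in)
    moreover have "\<alpha> a (Dom A' g) s \<in> Val V (on_ob F a) (on_ob F' (Dom A' g))"
      using \<alpha>[unfolded prof_nat_def] 1 a by (simp add: prof_restrict_def A'.Dom_in)
    ultimately show ?case
      using coend_class_step[of "on_arr F' g" B' "\<alpha> a (Dom A' g) s" V "on_ob F a"
          "\<beta> (Cod A' g) a'' t" V' "on_ob F'' a''" B B''] 1(1)
      by (simp add: F'.on_arr_in F'.Dom_on_arr F'.Cod_on_arr)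
  qed simp
qed

lemma is_functor_id_ffun: "category A \<Longrightarrow> is_functor A A id_ffun"
  by unfold_locales (simp_all add: id_ffun_def)

lemma prof_restrict_id_ffun: "prof_restrict V id_ffun id_ffun = V"
  by (cases V) (simp add: prof_restrict_def id_ffun_def)

lemma prof_nat_identity: "prof_nat A A' U U (\<lambda>_ _ s. s)"
  by (simp add: prof_nat_def)

text \<open>The associator is a map out of an iterated coend, so both layers must be constant on classes:
  moving along the inner variable \<open>n\<close> is a step in the target, and moving along the outer variable
  \<open>m\<close> is absorbed by the inner class of the target.\<close>

lemma prof_assoc_class:
  assumes A: "category A0" "category A1" "category A2" "category A3"
    and U: "profunctor A0 A1 U" and U': "profunctor A1 A2 U'" and U'': "profunctor A2 A3 U''"
    and a: "a \<in> Ob A0" and d: "d \<in> Ob A3"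
    and m: "m \<in> Ob A1" and s: "s \<in> Val U a m"
  shows "prof_assoc A0 A1 A2 A3 U'' U' U a d
      (coend_class A0 A1 A3 (prof_comp A1 A2 A3 U'' U') U a d
        (m, coend_class A1 A2 A3 U'' U' m d (n, r, t), s))
    = coend_class A0 A2 A3 U'' (prof_comp A0 A1 A2 U' U) a d
        (n, r, coend_class A0 A1 A2 U' U a n (m, t, s))"
proof -
  interpret A0: category A0 by fact
  interpret A1: category A1 by fact
  interpret A2: category A2 by fact
  interpret A3: category A3 by fact
  interpret U: profunctor A0 A1 U by fact
  interpret U': profunctor A1 A2 U' by fact
  interpret U'': profunctor A2 A3 U'' by fact
  let ?K = "\<lambda>m s (n, r, t). coend_class A0 A2 A3 U'' (prof_comp A0 A1 A2 U' U) a d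
    (n, r, coend_class A0 A1 A2 U' U a n (m, t, s))"
  have inner: "descend (?K m s) (coend_class A1 A2 A3 U'' U' m d (n, r, t)) = ?K m s (n, r, t)"
    if m: "m \<in> Ob A1" and s: "s \<in> Val U a m" for m s n r t
  proof (rule descend_coend_class, unfold prod.case, goal_cases)
    case (1 g t r)
    let ?c = "coend_class A0 A1 A2 U' U a (Dom A2 g) (m, t, s)"
    have c: "?c \<in> Val (prof_comp A0 A1 A2 U' U) a (Dom A2 g)"
      using m s 1 by (intro coend_class_in_prof_comp)
    have "Act (prof_comp A0 A1 A2 U' U) (Ident A0 a) g ?c
        = coend_class A0 A1 A2 U' U a (Cod A2 g) (m, Act U' (Ident A1 m) g t, s)"
      using Act_prof_comp_class[OF A(1-3) U U' A0.Ident_in[OF a] 1(1), of m t s] a m s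
      by (simp add: A0.Dom_Ident A0.Cod_Ident U.Act_Ident)
    then show ?case
      using coend_class_step[OF 1(1) c 1(3), of A0 A3] by simp
  qed
  show ?thesis
    unfolding prof_assoc_def
  proof (subst descend_coend_class, unfold prod.case, goal_cases)
    case (1 g s c)
    from 1(3) obtain n r t where n: "n \<in> Ob A2" and r: "r \<in> Val U'' n d"
      and t: "t \<in> Val U' (Cod A1 g) n"
      and c: "c = coend_class A1 A2 A3 U'' U' (Cod A1 g) d (n, r, t)"
      by (rule prof_comp_ValE)
    have "Act (prof_comp A1 A2 A3 U'' U') g (Ident A3 d) c
        = coend_class A1 A2 A3 U'' U' (Dom A1 g) d (n, r, Act U' g (Ident A2 n) t)"
      using Act_prof_comp_class[OF A(2-4) U' U'' 1(1) A3.Ident_in[OF d], of n r t] d n r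
      by (simp add: c A3.Dom_Ident A3.Cod_Ident U''.Act_Ident)
    moreover have "Act U (Ident A0 a) g s \<in> Val U a (Cod A1 g)"
      using U.Act_in[of "Ident A0 a" g s] 1 a
      by (simp add: A0.Ident_in A0.Dom_Ident A0.Cod_Ident)
    ultimately show ?case
      using coend_class_step[OF 1(1,2) t, of A0 A2] 1
      by (simp add: inner c A1.Dom_in A1.Cod_in)
  next
    case 2
    show ?case using inner[OF m s] by simp
  qed
qed

text \<open>For the co-Yoneda isomorphisms the identity profunctor enters only through its values and
  actions on the carriers, so it may be replaced by any profunctor \<open>E\<close> that agrees there.\<close>

lemma coyoneda_dom_class:
  assumes "category A" "category A'" and U: "profunctor A A' U"
    and E: "prof_eq A A E (hom_prof A)" and a: "a \<in> Ob A" and a': "a' \<in> Ob A'"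
  shows "coyoneda_dom A' U a a' (coend_class A A A' U E a a' (m, s, k))
    = Act U k (Ident A' a') s"
proof -
  interpret A: category A by fact
  interpret A': category A' by fact
  interpret U: profunctor A A' U by fact
  show ?thesis
    unfolding coyoneda_dom_def
  proof (subst descend_coend_class, unfold prod.case, goal_cases)
    case (1 g k s)
    have k: "k \<in> Arr A" "Dom A k = a" "Cod A k = Dom A g"
      using 1 a E by (auto simp: prof_eq_def hom_prof_def hom_set_def A.Dom_in)
    have "Act E (Ident A a) g k = Comp A g (Comp A k (Ident A a))"
      using E 1 a by (simp add: prof_eq_def hom_prof_def A.Ident_in A.Cod_Ident)
    also have "\<dots> = Comp A g k"
      using A.Comp_Ident_right[OF k(1)] k by simp
    finally show ?case
      using U.Act_Comp[of g k "Ident A' a'" "Ident A' a'" s] k 1 a'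
        A'.Comp_Ident_right[OF A'.Ident_in[OF a']]
      by (simp add: A'.Ident_in A'.Dom_Ident A'.Cod_Ident)
  qed simp
qed

lemma coyoneda_cod_class:
  assumes "category A" "category A'" and U: "profunctor A A' U"
    and E: "prof_eq A' A' E (hom_prof A')" and a: "a \<in> Ob A" and a': "a' \<in> Ob A'"
  shows "coyoneda_cod A U a a' (coend_class A A' A' E U a a' (m, k, s))
    = Act U (Ident A a) k s"
proof -
  interpret A: category A by fact
  interpret A': category A' by fact
  interpret U: profunctor A A' U by fact
  show ?thesis
    unfolding coyoneda_cod_def
  proof (subst descend_coend_class, unfold prod.case, goal_cases)
    case (1 g s k)
    have k: "k \<in> Arr A'" "Dom A' k = Cod A' g" "Cod A' k = a'"
      using 1 a' E by (auto simp: prof_eq_def hom_prof_def hom_set_def A'.Cod_in)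
    have "Act E g (Ident A' a') k = Comp A' (Ident A' a') (Comp A' k g)"
      using E 1 a' by (simp add: prof_eq_def hom_prof_def A'.Ident_in A'.Dom_Ident)
    also have "\<dots> = Comp A' k g"
      using A'.Comp_Ident_left[of "Comp A' k g"] k 1 by (simp add: A'.Comp_in A'.Cod_Comp)
    finally show ?case
      using U.Act_Comp[of "Ident A a" "Ident A a" g k s] k 1 a
        A.Comp_Ident_right[OF A.Ident_in[OF a]]
      by (simp add: A.Ident_in A.Dom_Ident A.Cod_Ident)
  qed simp
qed

section \<open>Membership in the Grothendieck construction\<close>

lemma groth_Obj_iff: "p \<in> groth_Obj C X \<longleftrightarrow> fst p \<in> Obj C \<and> snd p \<in> Ob (pcat X (fst p))"
  by (cases p) (simp add: groth_Obj_def)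

lemma groth_Hor_iff:
  "h \<in> groth_Hor C X \<longleftrightarrow> gh_dom h \<in> groth_Obj C X \<and> gh_cod h \<in> groth_Obj C X \<and>
    gh_base h \<in> Hor C \<and> hdom C (gh_base h) = fst (gh_dom h) \<and>
    hcod C (gh_base h) = fst (gh_cod h) \<and>
    snd (gh_dom h) = on_ob (pfun X (gh_base h)) (snd (gh_cod h))"
  by (cases h) (auto simp: groth_Hor_def)

lemma groth_Ver_iff:
  "u \<in> groth_Ver C X \<longleftrightarrow> gv_dom u \<in> groth_Obj C X \<and> gv_cod u \<in> groth_Obj C X \<and>
    gv_base u \<in> Ver C \<and> vdom C (gv_base u) = fst (gv_dom u) \<and>
    vcod C (gv_base u) = fst (gv_cod u) \<and>
    gv_elem u \<in> Val (pprof X (gv_base u)) (snd (gv_dom u)) (snd (gv_cod u))"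
  by (cases u) (auto simp: groth_Ver_def)

lemma groth_Sq_iff:
  "\<alpha> \<in> groth_Sq C X \<longleftrightarrow> gs_left \<alpha> \<in> groth_Ver C X \<and> gs_right \<alpha> \<in> groth_Ver C X \<and>
    gs_top \<alpha> \<in> groth_Hor C X \<and> gs_bot \<alpha> \<in> groth_Hor C X \<and>
    gv_dom (gs_left \<alpha>) = gh_dom (gs_top \<alpha>) \<and> gv_cod (gs_left \<alpha>) = gh_dom (gs_bot \<alpha>) \<and>
    gv_dom (gs_right \<alpha>) = gh_cod (gs_top \<alpha>) \<and> gv_cod (gs_right \<alpha>) = gh_cod (gs_bot \<alpha>) \<and>
    gs_base \<alpha> \<in> Sq C \<and>
    sq_left C (gs_base \<alpha>) = gv_base (gs_left \<alpha>) \<and> sq_right C (gs_base \<alpha>) = gv_base (gs_right \<alpha>) \<and>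
    sq_top C (gs_base \<alpha>) = gh_base (gs_top \<alpha>) \<and> sq_bot C (gs_base \<alpha>) = gh_base (gs_bot \<alpha>) \<and>
    gv_elem (gs_left \<alpha>) = psq X (gs_base \<alpha>) (snd (gv_dom (gs_right \<alpha>)))
      (snd (gv_cod (gs_right \<alpha>))) (gv_elem (gs_right \<alpha>))"
proof (cases \<alpha>)
  case (GSq l t b r \<beta>)
  then show ?thesis
    by (cases l; cases t; cases b; cases r) (auto simp: groth_Sq_def)
qed

lemmas category_laws =
  category.Dom_in category.Cod_in category.Ident_in category.Dom_Ident category.Cod_Ident
  category.Comp_in category.Dom_Comp category.Cod_Comp category.Comp_assoc
  category.Comp_Ident_right category.Comp_Ident_left

context lax_double_presheaf
begin

lemmas hor_laws = category_laws[OF hor, unfolded hor_cat_def cat.simps]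
lemmas ver_laws = category_laws[OF ver, unfolded ver_cat_def cat.simps]
lemmas sq_hor_laws = category_laws[OF sq_hor, unfolded sq_hor_cat_def cat.simps]
lemmas sq_ver_laws = category_laws[OF sq_ver, unfolded sq_ver_cat_def cat.simps]

text \<open>The unit laws of \<open>C\<close> with the boundary as a separate variable, so that they rewrite terms
  whose identities sit at an object named through the Grothendieck construction.\<close>

lemma base_unit_laws:
  "\<lbrakk>f \<in> Hor C; hdom C f = x\<rbrakk> \<Longrightarrow> hcomp C f (hid C x) = f"
  "\<lbrakk>f \<in> Hor C; hcod C f = y\<rbrakk> \<Longrightarrow> hcomp C (hid C y) f = f"
  "\<lbrakk>u \<in> Ver C; vdom C u = x\<rbrakk> \<Longrightarrow> vcomp C u (vid C x) = u"
  "\<lbrakk>u \<in> Ver C; vcod C u = x'\<rbrakk> \<Longrightarrow> vcomp C (vid C x') u = u"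
  "\<lbrakk>\<alpha> \<in> Sq C; sq_left C \<alpha> = u\<rbrakk> \<Longrightarrow> sq_hcomp C \<alpha> (sq_hid C u) = \<alpha>"
  "\<lbrakk>\<alpha> \<in> Sq C; sq_right C \<alpha> = v\<rbrakk> \<Longrightarrow> sq_hcomp C (sq_hid C v) \<alpha> = \<alpha>"
  "\<lbrakk>\<alpha> \<in> Sq C; sq_top C \<alpha> = f\<rbrakk> \<Longrightarrow> sq_vcomp C \<alpha> (sq_vid C f) = \<alpha>"
  "\<lbrakk>\<alpha> \<in> Sq C; sq_bot C \<alpha> = f'\<rbrakk> \<Longrightarrow> sq_vcomp C (sq_vid C f') \<alpha> = \<alpha>"
  using hor_laws(10,11) ver_laws(10,11) sq_hor_laws(10,11) sq_ver_laws(10,11) by auto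

section \<open>The horizontal category\<close>

lemma groth_hid_in: "p \<in> groth_Obj C X \<Longrightarrow> groth_hid C p \<in> groth_Hor C X"
  using X_hid[of "fst p"]
  by (simp add: groth_Hor_iff groth_hid_def groth_Obj_iff hor_laws ffun_eq_def id_ffun_def)

lemma groth_hcomp_in:
  assumes "f \<in> groth_Hor C X" "g \<in> groth_Hor C X" "gh_cod f = gh_dom g"
  shows "groth_hcomp C g f \<in> groth_Hor C X"
proof -
  have "snd (gh_dom f) = on_ob (pfun X (hcomp C (gh_base g) (gh_base f))) (snd (gh_cod g))"
    using assms X_hcomp[of "gh_base f" "gh_base g"]
    by (simp add: groth_Hor_iff groth_Obj_iff ffun_eq_def comp_ffun_def)
  then show ?thesis
    using assms unfolding groth_Hor_iff by (simp add: groth_hcomp_def hor_laws)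
qed

lemma hor_cat_grothendieck: "category (hor_cat (grothendieck C X))"
  by unfold_locales
    (auto simp: hor_cat_def grothendieck_def groth_hid_in groth_hcomp_in,
     auto simp: groth_Hor_iff groth_hid_def groth_hcomp_def hor_laws base_unit_laws
       intro!: groth_hor.expand)

section \<open>The vertical category\<close>

lemma groth_vid_in:
  assumes "p \<in> groth_Obj C X"
  shows "groth_vid C X p \<in> groth_Ver C X"
proof -
  interpret A: category "pcat X (fst p)"
    using assms by (simp add: X_cat groth_Obj_iff)
  show ?thesis
    using assms X_vid[of "fst p"]
    by (simp add: groth_Ver_iff groth_vid_def groth_Obj_iff ver_laws prof_eq_def hom_prof_def
        hom_set_def A.Ident_in A.Dom_Ident A.Cod_Ident)
qed

lemma groth_vcomp_in:
  assumes "u \<in> groth_Ver C X" "u' \<in> groth_Ver C X" "gv_cod u = gv_dom u'"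
  shows "groth_vcomp C X u' u \<in> groth_Ver C X"
  using assms X_mu[of "gv_base u" "gv_base u'"]
  by (simp add: groth_Ver_iff groth_vcomp_def groth_Obj_iff ver_laws prof_nat_def
      pcomp_def pclass_def coend_class_in_prof_comp)

text \<open>On representatives the associativity axiom reads \<open>\<mu>[\<mu>[r, t], s] = \<mu>[r, \<mu>[t, s]]\<close>: the left
  side applies \<open>\<mu>\<close> inside the first component, and the associator turns \<open>[[r, t], s]\<close> into \<open>[r, [t, s]]\<close>
  before \<open>\<mu>\<close> is applied inside the second.\<close>

lemma mu_assoc_class:
  assumes u: "u \<in> Ver C" "u' \<in> Ver C" "u'' \<in> Ver C" "vcod C u = vdom C u'" "vcod C u' = vdom C u''"
    and a: "a \<in> Ob (pcat X (vdom C u))" and d: "d \<in> Ob (pcat X (vcod C u''))"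
    and m: "m \<in> Ob (pcat X (vcod C u))" and n: "n \<in> Ob (pcat X (vcod C u'))"
    and s: "s \<in> Val (pprof X u) a m" and t: "t \<in> Val (pprof X u') m n"
    and r: "r \<in> Val (pprof X u'') n d"
  shows "pmu X u (vcomp C u'' u') a d
      (pclass C X (vcomp C u'' u') u a d (m, pmu X u' u'' m d (pclass C X u'' u' m d (n, r, t)), s))
    = pmu X (vcomp C u' u) u'' a d
      (pclass C X u'' (vcomp C u' u) a d (n, r, pmu X u u' a n (pclass C X u' u a n (m, t, s))))"
proof -
  define A0 A1 A2 A3 where A_defs: "A0 = pcat X (vdom C u)" "A1 = pcat X (vcod C u)"
    "A2 = pcat X (vcod C u')" "A3 = pcat X (vcod C u'')"
  have A: "category A0" "category A1" "category A2" "category A3"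
    using u by (simp_all add: A_defs X_cat ver_laws)
  have U: "profunctor A0 A1 (pprof X u)" "profunctor A1 A2 (pprof X u')"
    "profunctor A2 A3 (pprof X u'')"
    using u X_prof[of u] X_prof[of u'] X_prof[of u''] by (simp_all add: A_defs)
  have a: "a \<in> Ob A0" and d: "d \<in> Ob A3" and m: "m \<in> Ob A1" and n: "n \<in> Ob A2"
    using a d m n by (simp_all add: A_defs)
  have mu: "prof_nat A0 A2 (prof_comp A0 A1 A2 (pprof X u') (pprof X u))
      (pprof X (vcomp C u' u)) (pmu X u u')"
    using X_mu[of u u'] u by (simp add: A_defs pcomp_def)
  have mu': "prof_nat A1 A3 (prof_comp A1 A2 A3 (pprof X u'') (pprof X u'))
      (pprof X (vcomp C u'' u')) (pmu X u' u'')"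
    using X_mu[of u' u''] u by (simp add: A_defs pcomp_def)
  let ?c = "coend_class A1 A2 A3 (pprof X u'') (pprof X u') m d (n, r, t)"
  let ?b = "coend_class A0 A1 A2 (pprof X u') (pprof X u) a n (m, t, s)"
  let ?E = "prof_comp A1 A2 A3 (pprof X u'') (pprof X u')"
  let ?e = "coend_class A0 A1 A3 ?E (pprof X u) a d (m, ?c, s)"
  have e: "?e \<in> Val (prof_comp A0 A1 A3 (pcomp C X u'' u') (pprof X u)) a d"
    using u m n r s t by (auto simp: pcomp_def A_defs intro!: coend_class_in_prof_comp)
  have L: "prof_vcomp A0 A1 A3 (pprof X (vcomp C u'' u')) (pprof X u)
             id_ffun id_ffun id_ffun (pmu X u' u'') (\<lambda>_ _ s. s) a d ?e
      = coend_class A0 A1 A3 (pprof X (vcomp C u'' u')) (pprof X u) a d (m, pmu X u' u'' m d ?c, s)"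
    using A a d mu'
    by (subst prof_vcomp_class)
      (auto simp: is_functor_id_ffun prof_restrict_id_ffun prof_nat_identity, simp_all add: id_ffun_def)
  have R: "prof_vcomp A0 A2 A3 (pprof X u'') (pprof X (vcomp C u' u))
             id_ffun id_ffun id_ffun (\<lambda>_ _ s. s) (pmu X u u') a d
             (prof_assoc A0 A1 A2 A3 (pprof X u'') (pprof X u') (pprof X u) a d ?e)
      = coend_class A0 A2 A3 (pprof X u'') (pprof X (vcomp C u' u)) a d (n, r, pmu X u u' a n ?b)"
    using A a d mu
    by (subst prof_assoc_class[OF A U a d m s], subst prof_vcomp_class)
      (auto simp: is_functor_id_ffun prof_restrict_id_ffun prof_nat_identity, simp_all add: id_ffun_def)
  show ?thesis
    using mu_assoc[OF u A_defs a d e] u unfolding L R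
    by (simp add: pclass_def A_defs ver_laws)
qed

lemma groth_vcomp_assoc:
  assumes "u \<in> groth_Ver C X" "u' \<in> groth_Ver C X" "u'' \<in> groth_Ver C X"
    and "gv_cod u = gv_dom u'" "gv_cod u' = gv_dom u''"
  shows "groth_vcomp C X u'' (groth_vcomp C X u' u) = groth_vcomp C X (groth_vcomp C X u'' u') u"
  using assms
  by (simp add: groth_vcomp_def groth_Ver_iff groth_Obj_iff ver_laws mu_assoc_class)

text \<open>The composite with a vertical identity is the co-Yoneda image of \<open>[u\<^sub>-, 1]\<close>, that is, the action
  of an identity on \<open>u\<^sub>-\<close>.\<close>

lemma groth_vcomp_vid_right:
  assumes "u \<in> groth_Ver C X"
  shows "groth_vcomp C X u (groth_vid C X (gv_dom u)) = u"
proof -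
  obtain x a v s x' a' where u: "u = GVer (x, a) v s (x', a')"
    by (metis groth_ver.exhaust surj_pair)
  with assms have v: "v \<in> Ver C" "vdom C v = x" "vcod C v = x'" "x \<in> Obj C" "x' \<in> Obj C"
    and a: "a \<in> Ob (pcat X x)" and a': "a' \<in> Ob (pcat X x')" and s: "s \<in> Val (pprof X v) a a'"
    by (auto simp: groth_Ver_iff groth_Obj_iff)
  note A = X_cat[OF v(4)] X_cat[OF v(5)]
  have U: "profunctor (pcat X x) (pcat X x') (pprof X v)"
    using X_prof[OF v(1)] v by simp
  let ?c = "pclass C X v (vid C x) a a' (a, s, Ident (pcat X x) a)"
  have "groth_vid C X (x, a) \<in> groth_Ver C X"
    using v a by (intro groth_vid_in) (simp add: groth_Obj_iff)
  then have "?c \<in> Val (pcomp C X v (vid C x)) a a'"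
    using v a s by (simp add: pclass_def pcomp_def groth_vid_def groth_Ver_iff ver_laws
        coend_class_in_prof_comp)
  then have "pmu X (vid C x) v a a' ?c = coyoneda_dom (pcat X x') (pprof X v) a a' ?c"
    using mu_vid_dom[OF v(1), of a a' ?c] v a a' by simp
  also have "\<dots> = s"
    using coyoneda_dom_class[OF A U X_vid[OF v(4)] a a', of a s "Ident (pcat X x) a"] v a a' s
    by (simp add: pclass_def ver_laws profunctor.Act_Ident[OF U])
  finally show ?thesis
    using v by (simp add: u groth_vcomp_def groth_vid_def base_unit_laws)
qed

lemma groth_vcomp_vid_left:
  assumes "u \<in> groth_Ver C X"
  shows "groth_vcomp C X (groth_vid C X (gv_cod u)) u = u"
proof -
  obtain x a v s x' a' where u: "u = GVer (x, a) v s (x', a')"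
    by (metis groth_ver.exhaust surj_pair)
  with assms have v: "v \<in> Ver C" "vdom C v = x" "vcod C v = x'" "x \<in> Obj C" "x' \<in> Obj C"
    and a: "a \<in> Ob (pcat X x)" and a': "a' \<in> Ob (pcat X x')" and s: "s \<in> Val (pprof X v) a a'"
    by (auto simp: groth_Ver_iff groth_Obj_iff)
  note A = X_cat[OF v(4)] X_cat[OF v(5)]
  have U: "profunctor (pcat X x) (pcat X x') (pprof X v)"
    using X_prof[OF v(1)] v by simp
  let ?c = "pclass C X (vid C x') v a a' (a', Ident (pcat X x') a', s)"
  have "groth_vid C X (x', a') \<in> groth_Ver C X"
    using v a' by (intro groth_vid_in) (simp add: groth_Obj_iff)
  then have "?c \<in> Val (pcomp C X (vid C x') v) a a'"
    using v a' s by (simp add: pclass_def pcomp_def groth_vid_def groth_Ver_iff ver_laws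
        coend_class_in_prof_comp)
  then have "pmu X v (vid C x') a a' ?c = coyoneda_cod (pcat X x) (pprof X v) a a' ?c"
    using mu_vid_cod[OF v(1), of a a' ?c] v a a' by simp
  also have "\<dots> = s"
    using coyoneda_cod_class[OF A U X_vid[OF v(5)] a a', of a' "Ident (pcat X x') a'" s] v a a' s
    by (simp add: pclass_def ver_laws profunctor.Act_Ident[OF U])
  finally show ?thesis
    using v by (simp add: u groth_vcomp_def groth_vid_def base_unit_laws)
qed

lemma gv_vcomp [simp]:
  "gv_dom (groth_vcomp C X u' u) = gv_dom u" "gv_cod (groth_vcomp C X u' u) = gv_cod u'"
  "gv_base (groth_vcomp C X u' u) = vcomp C (gv_base u') (gv_base u)"
  by (simp_all add: groth_vcomp_def)

lemma gv_vid [simp]: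
  "gv_dom (groth_vid C X p) = p" "gv_cod (groth_vid C X p) = p"
  "gv_base (groth_vid C X p) = vid C (fst p)"
  by (simp_all add: groth_vid_def)

lemma gh_hcomp [simp]:
  "gh_dom (groth_hcomp C g f) = gh_dom f" "gh_cod (groth_hcomp C g f) = gh_cod g"
  "gh_base (groth_hcomp C g f) = hcomp C (gh_base g) (gh_base f)"
  by (simp_all add: groth_hcomp_def)

lemma gh_hid [simp]:
  "gh_dom (groth_hid C p) = p" "gh_cod (groth_hid C p) = p"
  "gh_base (groth_hid C p) = hid C (fst p)"
  by (simp_all add: groth_hid_def)

lemma ver_cat_grothendieck: "category (ver_cat (grothendieck C X))"
  by unfold_locales
    (auto simp: ver_cat_def grothendieck_def groth_vid_in groth_vcomp_in groth_vcomp_assoc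
       groth_vcomp_vid_left groth_vcomp_vid_right, auto simp: groth_Ver_iff)

section \<open>Squares\<close>

lemma groth_SqD:
  assumes "\<alpha> \<in> groth_Sq C X"
  shows "gs_left \<alpha> \<in> groth_Ver C X" "gs_right \<alpha> \<in> groth_Ver C X"
    "gs_top \<alpha> \<in> groth_Hor C X" "gs_bot \<alpha> \<in> groth_Hor C X"
    "gv_dom (gs_left \<alpha>) = gh_dom (gs_top \<alpha>)" "gv_cod (gs_left \<alpha>) = gh_dom (gs_bot \<alpha>)"
    "gv_dom (gs_right \<alpha>) = gh_cod (gs_top \<alpha>)" "gv_cod (gs_right \<alpha>) = gh_cod (gs_bot \<alpha>)"
    "gs_base \<alpha> \<in> Sq C"
    "sq_left C (gs_base \<alpha>) = gv_base (gs_left \<alpha>)" "sq_right C (gs_base \<alpha>) = gv_base (gs_right \<alpha>)"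
    "gv_elem (gs_left \<alpha>) = psq X (gs_base \<alpha>) (snd (gh_cod (gs_top \<alpha>)))
      (snd (gh_cod (gs_bot \<alpha>))) (gv_elem (gs_right \<alpha>))"
    "sq_top C (gs_base \<alpha>) = gh_base (gs_top \<alpha>)" "sq_bot C (gs_base \<alpha>) = gh_base (gs_bot \<alpha>)"
  using assms by (simp_all add: groth_Sq_iff)

lemma groth_base_simps:
  "f \<in> groth_Hor C X \<Longrightarrow> hdom C (gh_base f) = fst (gh_dom f)"
  "f \<in> groth_Hor C X \<Longrightarrow> hcod C (gh_base f) = fst (gh_cod f)"
  "f \<in> groth_Hor C X \<Longrightarrow> gh_base f \<in> Hor C"
  "u \<in> groth_Ver C X \<Longrightarrow> vdom C (gv_base u) = fst (gv_dom u)"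
  "u \<in> groth_Ver C X \<Longrightarrow> vcod C (gv_base u) = fst (gv_cod u)"
  "u \<in> groth_Ver C X \<Longrightarrow> gv_base u \<in> Ver C"
  by (simp_all add: groth_Hor_iff groth_Ver_iff)

lemma groth_fibre_facts:
  "f \<in> groth_Hor C X \<Longrightarrow> snd (gh_dom f) = on_ob (pfun X (gh_base f)) (snd (gh_cod f))"
  "u \<in> groth_Ver C X \<Longrightarrow> snd (gv_dom u) \<in> Ob (pcat X (vdom C (gv_base u)))"
  "u \<in> groth_Ver C X \<Longrightarrow> snd (gv_cod u) \<in> Ob (pcat X (vcod C (gv_base u)))"
  "u \<in> groth_Ver C X \<Longrightarrow> gv_elem u \<in> Val (pprof X (gv_base u)) (snd (gv_dom u)) (snd (gv_cod u))"
  by (auto simp: groth_Hor_iff groth_Ver_iff groth_Obj_iff)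

lemma groth_sq_hid_in:
  assumes "u \<in> groth_Ver C X"
  shows "sq_hid (grothendieck C X) u \<in> groth_Sq C X"
  using assms groth_hid_in[of "gv_dom u"] groth_hid_in[of "gv_cod u"]
  by (simp add: groth_Sq_iff grothendieck_def)
    (simp add: groth_Ver_iff groth_Obj_iff sq_hor_laws top_hid bot_hid X_sq_hid)

lemma groth_sq_hcomp_in:
  assumes "\<alpha> \<in> groth_Sq C X" "\<beta> \<in> groth_Sq C X" "gs_right \<alpha> = gs_left \<beta>"
  shows "sq_hcomp (grothendieck C X) \<beta> \<alpha> \<in> groth_Sq C X"
proof -
  have "groth_hcomp C (gs_top \<beta>) (gs_top \<alpha>) \<in> groth_Hor C X"
    "groth_hcomp C (gs_bot \<beta>) (gs_bot \<alpha>) \<in> groth_Hor C X"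
    using assms by (auto simp: groth_Sq_iff intro!: groth_hcomp_in)
  moreover have eq: "psq X (sq_hcomp C (gs_base \<beta>) (gs_base \<alpha>)) (snd (gv_dom (gs_right \<beta>)))
      (snd (gv_cod (gs_right \<beta>))) (gv_elem (gs_right \<beta>)) = gv_elem (gs_left \<alpha>)"
    using X_sq_hcomp[of "gs_base \<alpha>" "gs_base \<beta>" "snd (gv_dom (gs_right \<beta>))"
        "snd (gv_cod (gs_right \<beta>))" "gv_elem (gs_right \<beta>)"] assms
      groth_fibre_facts(2-4)[of "gs_right \<beta>"]
      groth_fibre_facts(1)[of "gs_top \<beta>"] groth_fibre_facts(1)[of "gs_bot \<beta>"]
      groth_SqD[of \<alpha>] groth_SqD[of \<beta>]
    by simp
  ultimately show ?thesis
    using assms eq[symmetric]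
    by (simp add: groth_Sq_iff grothendieck_def sq_hor_laws top_hcomp bot_hcomp)
qed

text \<open>Normality makes \<open>Xe\<^sub>f\<close> the action of \<open>Xf\<close>, which preserves the identity carried by a vertical
  identity morphism.\<close>

lemma groth_sq_vid_in:
  assumes f: "f \<in> groth_Hor C X"
  shows "sq_vid (grothendieck C X) f \<in> groth_Sq C X"
proof -
  have b: "gh_base f \<in> Hor C" "fst (gh_cod f) = hcod C (gh_base f)"
    "fst (gh_dom f) = hdom C (gh_base f)" "snd (gh_cod f) \<in> Ob (pcat X (hcod C (gh_base f)))"
    "snd (gh_dom f) = on_ob (pfun X (gh_base f)) (snd (gh_cod f))"
    "hcod C (gh_base f) \<in> Obj C"
    using f by (auto simp: groth_Hor_iff groth_Obj_iff)
  interpret A: category "pcat X (hcod C (gh_base f))"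
    using b by (simp add: X_cat)
  have "psq X (sq_vid C (gh_base f)) (snd (gh_cod f)) (snd (gh_cod f))
      (Ident (pcat X (hcod C (gh_base f))) (snd (gh_cod f)))
    = Ident (pcat X (hdom C (gh_base f))) (snd (gh_dom f))"
    using X_sq_vid[OF b(1) A.Ident_in[OF b(4)]] b is_functor.on_arr_Ident[OF X_fun[OF b(1)] b(4)]
    by (simp add: A.Dom_Ident A.Cod_Ident)
  moreover have "groth_vid C X (gh_dom f) \<in> groth_Ver C X" "groth_vid C X (gh_cod f) \<in> groth_Ver C X"
    using f by (auto simp: groth_Hor_iff intro!: groth_vid_in)
  ultimately show ?thesis
    using f b
    by (simp add: groth_Sq_iff grothendieck_def sq_ver_laws left_vid right_vid)
      (simp add: groth_vid_def)
qed

text \<open>On representatives naturality reads \<open>X(\<alpha>' \<bullet> \<alpha>)(\<mu>[t, s]) = \<mu>[X\<alpha>'(t), X\<alpha>(s)]\<close>, which is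
  exactly the condition for the vertical composite of two squares to be a square.\<close>

lemma mu_natural_class:
  assumes sq: "\<alpha> \<in> Sq C" "\<alpha>' \<in> Sq C" "sq_bot C \<alpha> = sq_top C \<alpha>'"
    and y: "y \<in> Ob (pcat X (vdom C (sq_right C \<alpha>)))"
    and y': "y' \<in> Ob (pcat X (vcod C (sq_right C \<alpha>)))"
    and y'': "y'' \<in> Ob (pcat X (vcod C (sq_right C \<alpha>')))"
    and s: "s \<in> Val (pprof X (sq_right C \<alpha>)) y y'"
    and t: "t \<in> Val (pprof X (sq_right C \<alpha>')) y' y''"
  shows "psq X (sq_vcomp C \<alpha>' \<alpha>) y y'' (pmu X (sq_right C \<alpha>) (sq_right C \<alpha>') y y''
        (pclass C X (sq_right C \<alpha>') (sq_right C \<alpha>) y y'' (y', t, s)))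
    = pmu X (sq_left C \<alpha>) (sq_left C \<alpha>')
        (on_ob (pfun X (sq_top C \<alpha>)) y) (on_ob (pfun X (sq_bot C \<alpha>')) y'')
        (pclass C X (sq_left C \<alpha>') (sq_left C \<alpha>)
          (on_ob (pfun X (sq_top C \<alpha>)) y) (on_ob (pfun X (sq_bot C \<alpha>')) y'')
          (on_ob (pfun X (sq_bot C \<alpha>)) y', psq X \<alpha>' y' y'' t, psq X \<alpha> y y' s))"
proof -
  note corners = corner_left_top corner_left_bot corner_right_top corner_right_bot
  have mid: "vdom C (sq_right C \<alpha>') = vcod C (sq_right C \<alpha>)"
    "vdom C (sq_left C \<alpha>') = vcod C (sq_left C \<alpha>)"
    using sq by (simp_all add: corners)
  let ?B = "pcat X (vdom C (sq_right C \<alpha>))" and ?B' = "pcat X (vcod C (sq_right C \<alpha>))"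
    and ?B'' = "pcat X (vcod C (sq_right C \<alpha>'))"
  let ?A = "pcat X (vdom C (sq_left C \<alpha>))" and ?A' = "pcat X (vcod C (sq_left C \<alpha>))"
    and ?A'' = "pcat X (vcod C (sq_left C \<alpha>'))"
  have cats: "category ?B" "category ?B'" "category ?B''"
    using sq by (simp_all add: X_cat ver_laws sq_hor_laws)
  have funs: "is_functor ?B ?A (pfun X (sq_top C \<alpha>))" "is_functor ?B' ?A' (pfun X (sq_bot C \<alpha>))"
    "is_functor ?B'' ?A'' (pfun X (sq_bot C \<alpha>'))"
    using sq by (simp_all add: corners X_fun sq_ver_laws)
  have nat: "prof_nat ?B ?B' (pprof X (sq_right C \<alpha>))
      (prof_restrict (pprof X (sq_left C \<alpha>)) (pfun X (sq_top C \<alpha>)) (pfun X (sq_bot C \<alpha>))) (psq X \<alpha>)"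
    "prof_nat ?B' ?B'' (pprof X (sq_right C \<alpha>'))
      (prof_restrict (pprof X (sq_left C \<alpha>')) (pfun X (sq_bot C \<alpha>)) (pfun X (sq_bot C \<alpha>'))) (psq X \<alpha>')"
    using X_sq[OF sq(1)] X_sq[OF sq(2)] by (simp_all add: mid sq(3))
  have "pclass C X (sq_right C \<alpha>') (sq_right C \<alpha>) y y'' (y', t, s)
      \<in> Val (pcomp C X (sq_right C \<alpha>') (sq_right C \<alpha>)) y y''"
    using y' s t by (simp add: pclass_def pcomp_def coend_class_in_prof_comp)
  from mu_natural[OF sq y y'' this] show ?thesis
    unfolding pclass_def
    by (simp add: prof_vcomp_class[OF cats(1,3) funs nat cats(2) y y''])
qed

lemma groth_sq_vcomp_in:
  assumes "\<alpha> \<in> groth_Sq C X" "\<alpha>' \<in> groth_Sq C X" "gs_bot \<alpha> = gs_top \<alpha>'"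
  shows "sq_vcomp (grothendieck C X) \<alpha>' \<alpha> \<in> groth_Sq C X"
proof -
  have "groth_vcomp C X (gs_left \<alpha>') (gs_left \<alpha>) \<in> groth_Ver C X"
    "groth_vcomp C X (gs_right \<alpha>') (gs_right \<alpha>) \<in> groth_Ver C X"
    using assms by (auto simp: groth_Sq_iff intro!: groth_vcomp_in)
  moreover have "gv_elem (groth_vcomp C X (gs_left \<alpha>') (gs_left \<alpha>))
    = psq X (sq_vcomp C (gs_base \<alpha>') (gs_base \<alpha>)) (snd (gv_dom (gs_right \<alpha>)))
        (snd (gv_cod (gs_right \<alpha>'))) (gv_elem (groth_vcomp C X (gs_right \<alpha>') (gs_right \<alpha>)))"
    using mu_natural_class[of "gs_base \<alpha>" "gs_base \<alpha>'" "snd (gv_dom (gs_right \<alpha>))"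
        "snd (gv_cod (gs_right \<alpha>))" "snd (gv_cod (gs_right \<alpha>'))" "gv_elem (gs_right \<alpha>)"
        "gv_elem (gs_right \<alpha>')"] assms
      groth_fibre_facts(2-4)[of "gs_right \<alpha>"] groth_fibre_facts(2-4)[of "gs_right \<alpha>'"]
      groth_fibre_facts(1)[of "gs_top \<alpha>"] groth_fibre_facts(1)[of "gs_bot \<alpha>"]
      groth_fibre_facts(1)[of "gs_bot \<alpha>'"] groth_SqD[of \<alpha>] groth_SqD[of \<alpha>']
    by (simp add: groth_vcomp_def)
  ultimately show ?thesis
    using assms by (simp add: groth_Sq_iff grothendieck_def sq_ver_laws left_vcomp right_vcomp)
qed

lemmas groth_hor_laws = category_laws[OF hor_cat_grothendieck,
  unfolded hor_cat_def grothendieck_def cat.simps double_cat.simps]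
lemmas groth_ver_laws = category_laws[OF ver_cat_grothendieck,
  unfolded ver_cat_def grothendieck_def cat.simps double_cat.simps]

lemma groth_sq_boundary_simps:
  "gs_left (sq_hid (grothendieck C X) u) = u" "gs_right (sq_hid (grothendieck C X) u) = u"
  "gs_left (sq_hcomp (grothendieck C X) \<beta> \<alpha>) = gs_left \<alpha>"
  "gs_right (sq_hcomp (grothendieck C X) \<beta> \<alpha>) = gs_right \<beta>"
  "gs_top (sq_vid (grothendieck C X) f) = f" "gs_bot (sq_vid (grothendieck C X) f) = f"
  "gs_top (sq_vcomp (grothendieck C X) \<alpha>' \<alpha>) = gs_top \<alpha>"
  "gs_bot (sq_vcomp (grothendieck C X) \<alpha>' \<alpha>) = gs_bot \<alpha>'"
  by (simp_all add: grothendieck_def)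

text \<open>The laws in both categories of squares are checked component by component: boundaries
  compose in the categories of horizontal and vertical morphisms already treated, and the underlying
  squares compose in \<open>C\<close>.\<close>

lemma sq_hor_cat_grothendieck: "category (sq_hor_cat (grothendieck C X))"
proof -
  have carriers: "Ver (grothendieck C X) = groth_Ver C X" "Sq (grothendieck C X) = groth_Sq C X"
    "sq_left (grothendieck C X) = gs_left" "sq_right (grothendieck C X) = gs_right"
    by (simp_all add: grothendieck_def)
  show ?thesis
    unfolding sq_hor_cat_def
  proof (unfold_locales, unfold cat.simps carriers, goal_cases)
    \<comment> \<open>Cases 9 to 11 are associativity and the two unit laws; the rest concerns boundaries.\<close>
    case (9 f g h)
    then show ?case
      by (simp add: grothendieck_def groth_hor_laws groth_SqD sq_hor_laws)
        (metis groth_SqD groth_hor_laws(9))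
  next
    case (10 f)
    then show ?case
      by (intro groth_sq.expand) (simp add: grothendieck_def groth_SqD groth_hor_laws base_unit_laws)
  next
    case (11 f)
    then show ?case
      by (intro groth_sq.expand) (simp add: grothendieck_def groth_SqD groth_hor_laws base_unit_laws)
  qed (auto simp: groth_SqD groth_sq_hid_in groth_sq_hcomp_in groth_sq_boundary_simps)
qed

lemma sq_ver_cat_grothendieck: "category (sq_ver_cat (grothendieck C X))"
proof -
  have carriers: "Hor (grothendieck C X) = groth_Hor C X" "Sq (grothendieck C X) = groth_Sq C X"
    "sq_top (grothendieck C X) = gs_top" "sq_bot (grothendieck C X) = gs_bot"
    by (simp_all add: grothendieck_def)
  show ?thesis
    unfolding sq_ver_cat_def
  proof (unfold_locales, unfold cat.simps carriers, goal_cases)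
    \<comment> \<open>Cases 9 to 11 are associativity and the two unit laws; the rest concerns boundaries.\<close>
    case (9 f g h)
    then show ?case
      by (simp add: grothendieck_def groth_ver_laws groth_SqD sq_ver_laws)
  next
    case (10 f)
    then show ?case
      using groth_vcomp_vid_right[of "gs_left f"] groth_vcomp_vid_right[of "gs_right f"]
      by (intro groth_sq.expand) (simp add: grothendieck_def groth_SqD groth_ver_laws base_unit_laws)
  next
    case (11 f)
    then show ?case
      using groth_vcomp_vid_left[of "gs_left f"] groth_vcomp_vid_left[of "gs_right f"]
      by (intro groth_sq.expand) (simp add: grothendieck_def groth_SqD groth_ver_laws base_unit_laws)
  qed (auto simp: groth_SqD groth_sq_vid_in groth_sq_vcomp_in groth_sq_boundary_simps)
qed

lemma double_category_grothendieck: "double_category (grothendieck C X)"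
  by (rule double_category.intro[OF hor_cat_grothendieck ver_cat_grothendieck
      sq_hor_cat_grothendieck sq_ver_cat_grothendieck])
    (simp_all add: grothendieck_def groth_SqD groth_base_simps interchange hcomp_vid vcomp_hid vid_hid
      groth_Obj_iff)

end

theorem lemma6p1p2:
  fixes C :: "('o, 'h, 'v, 's) double_cat"
    and X :: "('o, 'h, 'v, 's, 'a, 'e) double_presheaf"
  assumes "double_category C"
    and "lax_double_presheaf C X"
  shows "double_category (grothendieck C X)"
  using assms(2) by (rule lax_double_presheaf.double_category_grothendieck)

end
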